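(* Let $q$ be an odd prime power, $\mathbb{F}_q$ the field with $q$ elements, and let $d,k\ge 1$. Let $h_1(\mathbf{x}),\ldots,h_k(\mathbf{x})\in\mathbb{F}_q[x_1,\ldots,x_d]$ be fixed polynomials of degree at most $q-1$, and let $\mathbf{b}_i=(b_{i1},\ldots,b_{id})\in(\mathbb{Z}^+)^d$ ($1\le i\le k$) be fixed vectors with $\gcd(b_{ij},q-1)=1$ for all $i,j$. For $\mathbf{a}_i=(a_{i1},\ldots,a_{id},a_{i(d+1)})\in\mathbb{F}_q^{d+1}$ put $$f_i(\mathbf{x},\mathbf{a}_i)=h_i(\mathbf{x})+\sum_{j=1}^d a_{ij}x_j^{b_{ij}}+a_{i(d+1)},$$ and $$V_{\mathbf{a}_1,\ldots,\mathbf{a}_k}=\{(\mathbf{x},x_{d+1},\ldots,x_{d+k})\in\mathbb{F}_q^{d+k}: x_{d+i}=f_i(\mathbf{x},\mathbf{a}_i)\text{ for all }1\le i\le k\}.$$ Let $\mathcal{P}$ be a set of points in $\mathbb{F}_q^d\times\mathbb{F}_q^k$ and $\mathcal{V}$ a set of varieties of the form $V_{\mathbf{a}_1,\ldots,\mathbf{a}_k}$. Then the number $I(\mathcal{P},\mathcal{V})=|\{(p,v)\in\mathcal{P}\times\mathcal{V}: p\in v\}|$ of incidences satisfies $$\left|I(\mathcal{P},\mathcal{V})-\frac{|\mathcal{P}||\mathcal{V}|}{q^k}\right|\le q^{dk/2}\sqrt{|\mathcal{P}||\mathcal{V}|}.$$ *)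

theory Defs
  imports "HOL-Analysis.Finite_Cartesian_Product" "HOL-Library.Poly_Mapping"
begin

text \<open>Multivariate polynomials with coefficients in \<open>'a\<close> and variables indexed by the
  finite type \<open>'d\<close>: a monomial is its exponent vector of type \<open>'d \<Rightarrow>\<^sub>0 nat\<close>.\<close>

type_synonym ('a, 'd) mpoly = "('d \<Rightarrow>\<^sub>0 nat) \<Rightarrow>\<^sub>0 'a"

definition mpoly_eval :: "('a::field, 'd::finite) mpoly \<Rightarrow> 'a ^ 'd \<Rightarrow> 'a" where
  "mpoly_eval p x =
     (\<Sum>m\<in>Poly_Mapping.keys p. Poly_Mapping.lookup p m * (\<Prod>j\<in>UNIV. (x $ j) ^ Poly_Mapping.lookup m j))"

text \<open>Total degree; the zero polynomial gets degree \<open>0\<close>.\<close>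

definition mpoly_degree :: "('a::field, 'd::finite) mpoly \<Rightarrow> nat" where
  "mpoly_degree p = Max (insert 0 ((\<lambda>m. \<Sum>j\<in>UNIV. Poly_Mapping.lookup m j) ` Poly_Mapping.keys p))"

text \<open>A coefficient vector \<open>(a\<^sub>1, \<dots>, a\<^sub>d, a\<^sub>d\<^sub>+\<^sub>1)\<close> is represented as the pair of
  \<open>(a\<^sub>1, \<dots>, a\<^sub>d)\<close> and \<open>a\<^sub>d\<^sub>+\<^sub>1\<close>, that is, the space of such vectors is taken to be
  \<open>('a ^ 'd) \<times> 'a\<close>.\<close>

definition fpoly ::
  "('a::field, 'd::finite) mpoly \<Rightarrow> nat ^ 'd \<Rightarrow> 'a ^ 'd \<Rightarrow> ('a ^ 'd) \<times> 'a \<Rightarrow> 'a" where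
  "fpoly h b x a = mpoly_eval h x + (\<Sum>j\<in>UNIV. fst a $ j * (x $ j) ^ (b $ j)) + snd a"

text \<open>The ambient space of dimension \<open>d + k\<close> is \<open>('a ^ 'd) \<times> ('a ^ 'k)\<close>; the component \<open>y $ i\<close>
  is the coordinate \<open>x\<^sub>d\<^sub>+\<^sub>i\<close>.\<close>

definition variety ::
  "('k::finite \<Rightarrow> ('a::field, 'd::finite) mpoly) \<Rightarrow> ('k \<Rightarrow> nat ^ 'd) \<Rightarrow> ('k \<Rightarrow> ('a ^ 'd) \<times> 'a)
    \<Rightarrow> (('a ^ 'd) \<times> ('a ^ 'k)) set" where
  "variety h b a = {(x, y). \<forall>i. y $ i = fpoly (h i) (b i) x (a i)}"

definition incidences :: "'p set \<Rightarrow> 'p set set \<Rightarrow> nat" where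
  "incidences P \<V> = card {(p, v) \<in> P \<times> \<V>. p \<in> v}"

end

theory Submission
  imports Defs "HOL-Analysis.Convex"
begin

text \<open>Since \<open>gcd b (q - 1) = 1\<close>, the map \<open>x \<mapsto> x ^ b\<close> is injective on the field. Hence two distinct
  points with different first components impose independent affine conditions on the coefficient
  vectors, and two distinct points with the same first component lie on no common variety. So the
  events that the points lie on the variety of a uniformly random coefficient family are pairwise
  uncorrelated or negatively correlated, and the bound follows from estimating the variance of the
  number of points of \<open>P\<close> on a random variety, with Cauchy--Schwarz over \<open>\<V>\<close>.\<close>

text \<open>Second moment method. Among the \<open>Q * D\<close> parameters a point is hit with
  density \<open>1 / Q\<close>, and \<open>D / Q\<close> common parameters is what independence
  would give. So off-diagonal covariances are at most zero, and only the diagonal contributes to the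
  bound on the variance.\<close>

lemma incidence_bound_of_pairwise_codegree:
  fixes R :: "'p \<Rightarrow> 'v::finite \<Rightarrow> bool" and D Q :: real
  assumes "finite P" "Q > 0"
    and degree: "\<And>p. p \<in> P \<Longrightarrow> real (card {v. R p v}) = D"
    and codegree: "\<And>p p'. p \<in> P \<Longrightarrow> p' \<in> P \<Longrightarrow> p \<noteq> p' \<Longrightarrow>
      real (card {v. R p v \<and> R p' v}) \<le> D / Q"
    and card_v: "real CARD('v) = Q * D"
  shows "\<bar>real (card {(p, v) \<in> P \<times> S. R p v}) - real (card P) * real (card S) / Q\<bar>
    \<le> sqrt (D * (real (card P) * real (card S)))"
proof -
  define n where "n v = (\<Sum>p\<in>P. of_bool (R p v) :: real)" for v
  define m where "m = real (card P) / Q"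
  have D: "D \<ge> 0"
    using card_v \<open>Q > 0\<close> by (metis of_nat_0_le_iff zero_le_mult_iff not_less)
  have n_sum: "(\<Sum>v\<in>UNIV. n v) = card P * D"
    unfolding n_def by (subst sum.swap) (simp add: degree)
  have pair: "(\<Sum>v\<in>UNIV. of_bool (R p v) * of_bool (R p' v)) \<le> D * of_bool (p = p') + D / Q"
    if "p \<in> P" "p' \<in> P" for p p'
  proof -
    have "(\<Sum>v\<in>UNIV. of_bool (R p v) * of_bool (R p' v)) = real (card {v. R p v \<and> R p' v})"
      by (simp flip: of_bool_conj)
    then show ?thesis
      using codegree[OF that] degree[of p] that D \<open>Q > 0\<close> by (cases "p = p'") auto
  qed
  have "(\<Sum>v\<in>UNIV. (n v)\<^sup>2) = (\<Sum>v\<in>UNIV. \<Sum>p\<in>P. \<Sum>p'\<in>P. of_bool (R p v) * of_bool (R p' v))"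
    unfolding n_def power2_eq_square sum_product ..
  also have "\<dots> = (\<Sum>p\<in>P. \<Sum>p'\<in>P. \<Sum>v\<in>UNIV. of_bool (R p v) * of_bool (R p' v))"
    by (subst sum.swap, rule sum.cong[OF refl], rule sum.swap)
  also have "\<dots> \<le> (\<Sum>p\<in>P. \<Sum>p'\<in>P. D * of_bool (p = p') + D / Q)"
    by (intro sum_mono pair)
  also have "\<dots> = card P * D + (card P)\<^sup>2 * D / Q"
  proof -
    have "(\<Sum>p'\<in>P. D * of_bool (p = p')) = D" if "p \<in> P" for p
      using that \<open>finite P\<close> by (simp add: of_bool_def if_distrib cong: if_cong)
    then show ?thesis
      by (simp add: sum.distrib power2_eq_square algebra_simps)
  qed
  finally have n_sq: "(\<Sum>v\<in>UNIV. (n v)\<^sup>2) \<le> card P * D + (card P)\<^sup>2 * D / Q" .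
  have "(\<Sum>v\<in>UNIV. (n v - m)\<^sup>2) = (\<Sum>v\<in>UNIV. (n v)\<^sup>2) - 2 * m * (\<Sum>v\<in>UNIV. n v) + CARD('v) * m\<^sup>2"
    by (simp add: power2_diff sum.distrib sum_subtractf sum_distrib_left sum_distrib_right algebra_simps)
  \<comment> \<open>Since \<open>m = card P / Q\<close>, the last two terms add up to
    \<open>- (card P)\<^sup>2 * D / Q\<close>, which cancels the quadratic part of
    \<open>n_sq\<close>.\<close>
  also have "\<dots> \<le> card P * D"
    using n_sq \<open>Q > 0\<close> unfolding n_sum card_v
    by (simp add: m_def power2_eq_square field_simps)
  finally have var: "(\<Sum>v\<in>UNIV. (n v - m)\<^sup>2) \<le> card P * D" .
  have "{(p, v) \<in> P \<times> S. R p v} = (SIGMA v:S. {p \<in> P. R p v})\<inverse>"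
    by auto
  then have "real (card {(p, v) \<in> P \<times> S. R p v}) = (\<Sum>v\<in>S. n v)"
    using \<open>finite P\<close> by (simp add: n_def card_SigmaI Int_def)
  then have "real (card {(p, v) \<in> P \<times> S. R p v}) - real (card P) * real (card S) / Q = (\<Sum>v\<in>S. n v - m)"
    by (simp add: sum_subtractf m_def)
  moreover have "(\<Sum>v\<in>S. n v - m)\<^sup>2 \<le> D * (real (card P) * real (card S))"
  proof -
    have "(\<Sum>v\<in>S. n v - m)\<^sup>2 \<le> (\<Sum>v\<in>S. (n v - m)\<^sup>2) * card S"
      by (rule sum_squared_le_sum_of_squares)
    \<comment> \<open>The terms are squares, so passing from \<open>S\<close> to all parameters only
      increases the sum.\<close>
    also have "\<dots> \<le> (\<Sum>v\<in>UNIV. (n v - m)\<^sup>2) * card S"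
      by (intro mult_right_mono sum_mono2) auto
    also have "\<dots> \<le> (card P * D) * card S"
      by (intro mult_right_mono var) auto
    finally show ?thesis by (simp add: mult_ac)
  qed
  ultimately show ?thesis
    by (metis real_sqrt_abs real_sqrt_le_iff)
qed

text \<open>Fermat's little theorem: multiplication by a nonzero \<open>x\<close> permutes the
  nonzero elements, so it leaves their product unchanged.\<close>

lemma power_card_eq_same:
  fixes x :: "'a::{field,finite}"
  shows "x ^ CARD('a) = x"
proof (cases "x = 0")
  case False
  have "(\<Prod>y\<in>UNIV - {0}. y) = (\<Prod>y\<in>UNIV - {0}. x * y)"
    by (rule prod.reindex_bij_witness[of _ "\<lambda>y. x * y" "\<lambda>y. y / x"]) (use False in auto)
  also have "\<dots> = x ^ (CARD('a) - 1) * (\<Prod>y\<in>UNIV - {0}. y)"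
    by (simp add: prod.distrib)
  finally have "x ^ (CARD('a) - 1) = 1"
    by simp
  moreover have "x ^ CARD('a) = x * x ^ (CARD('a) - 1)"
    using power_Suc[of x "CARD('a) - 1"] by simp
  ultimately show ?thesis
    by simp
qed simp

text \<open>A Bezout coefficient \<open>s\<close> of \<open>b\<close> modulo
  \<open>CARD('a) - 1\<close> yields the left inverse, raising to the power
  \<open>s\<close>.\<close>

lemma inj_power_coprime_card:
  fixes b :: nat
  assumes "b > 0" "gcd b (CARD('a) - 1) = 1"
  shows "inj (\<lambda>x :: 'a::{field,finite}. x ^ b)"
proof -
  obtain s t where st: "b * s = (CARD('a) - 1) * t + 1"
    using bezout_nat[of b "CARD('a) - 1"] assms by auto
  have "x ^ (b * s) = x" for x :: 'a
    \<comment> \<open>The summand 1 keeps the exponent positive, so the induction also covers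
      \<open>x = 0\<close>, where the power \<open>CARD('a) - 1\<close> is not 1.\<close>
    unfolding st
  proof (induction t)
    case (Suc t)
    have "x ^ ((CARD('a) - 1) * Suc t + 1) = x ^ ((CARD('a) - 1) * t + 1) * x ^ (CARD('a) - 1)"
      by (simp flip: power_add add: algebra_simps)
    also have "\<dots> = x ^ Suc (CARD('a) - 1)"
      by (simp only: Suc power_Suc)
    also have "\<dots> = x"
      by (simp add: power_card_eq_same)
    finally show ?case .
  qed simp
  then show ?thesis
    by (metis (no_types, lifting) injI power_mult)
qed

text \<open>Translation along a coordinate where \<open>w\<close> is nonzero changes the form by any
  prescribed amount, so all fibres have equal size and partition the space.\<close>

lemma card_linear_form_fibre:
  fixes w :: "'a::{field,finite} ^ 'd::finite"
  assumes "w \<noteq> 0"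
  shows "CARD('a) * card {u :: 'a ^ 'd. (\<Sum>j\<in>UNIV. u $ j * w $ j) = c} = CARD('a) ^ CARD('d)"
proof -
  define L where "L u = (\<Sum>j\<in>UNIV. u $ j * w $ j)" for u :: "'a ^ 'd"
  obtain k where k: "w $ k \<noteq> 0"
    using assms by (auto simp: vec_eq_iff)
  have L_shift: "L (u + axis k t) = L u + t * w $ k" for u t
  proof -
    have "(\<Sum>j\<in>UNIV. axis k t $ j * w $ j) = (\<Sum>j\<in>UNIV. if j = k then t * w $ k else 0)"
      by (intro sum.cong) (auto simp: axis_def)
    then show ?thesis
      by (simp add: L_def distrib_right sum.distrib)
  qed
  have same: "card {u. L u = e} = card {u. L u = c}" for e
  proof (rule bij_betw_same_card)
    show "bij_betw (\<lambda>u. u + axis k ((c - e) / w $ k)) {u. L u = e} {u. L u = c}"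
      by (rule bij_betw_byWitness[where f' = "\<lambda>u. u + axis k ((e - c) / w $ k)"])
        (auto simp: L_shift k, auto simp: vec_eq_iff axis_def k field_simps)
  qed
  have "CARD('a) ^ CARD('d) = card (\<Union>e. {u. L u = e})"
    by (subst CARD_vec[symmetric]) (rule arg_cong[where f = card], auto)
  also have "\<dots> = (\<Sum>e\<in>UNIV. card {u. L u = e})"
    by (rule card_UN_disjoint) auto
  also have "\<dots> = CARD('a) * card {u. L u = c}"
    by (subst sum.cong[OF refl same]) simp_all
  finally show ?thesis
    by (simp add: L_def)
qed

text \<open>The constant term is determined by the other coefficients, so the solutions form a graph
  over \<open>'a ^ 'd\<close>.\<close>

lemma card_affine_condition:
  fixes w :: "'a::{field,finite} ^ 'd::finite"
  shows "card {a :: ('a ^ 'd) \<times> 'a. (\<Sum>j\<in>UNIV. fst a $ j * w $ j) + snd a = c} = CARD('a) ^ CARD('d)"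
proof -
  have "{a :: ('a ^ 'd) \<times> 'a. (\<Sum>j\<in>UNIV. fst a $ j * w $ j) + snd a = c}
    = (\<lambda>u. (u, c - (\<Sum>j\<in>UNIV. u $ j * w $ j))) ` UNIV"
    by (auto simp: image_iff algebra_simps)
  then show ?thesis
    by (simp add: card_image inj_on_def)
qed

text \<open>Subtracting the conditions eliminates the constant term and leaves one equation for the
  nonzero form \<open>w - w'\<close>; the solutions form a graph over that fibre.\<close>

lemma card_two_affine_conditions:
  fixes w w' :: "'a::{field,finite} ^ 'd::finite"
  assumes "w \<noteq> w'"
  shows "CARD('a) * card {a :: ('a ^ 'd) \<times> 'a. (\<Sum>j\<in>UNIV. fst a $ j * w $ j) + snd a = c
    \<and> (\<Sum>j\<in>UNIV. fst a $ j * w' $ j) + snd a = c'} = CARD('a) ^ CARD('d)"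
proof -
  let ?L = "\<lambda>w u. \<Sum>j\<in>UNIV. (u :: 'a ^ 'd) $ j * w $ j"
  have diff: "?L (w - w') u = ?L w u - ?L w' u" for u
    by (simp add: algebra_simps sum_subtractf)
  have "{a :: ('a ^ 'd) \<times> 'a. ?L w (fst a) + snd a = c \<and> ?L w' (fst a) + snd a = c'}
    = (\<lambda>u. (u, c - ?L w u)) ` {u. ?L (w - w') u = c - c'}"
    unfolding diff by (auto simp: image_iff algebra_simps)
  then have "card {a :: ('a ^ 'd) \<times> 'a. ?L w (fst a) + snd a = c \<and> ?L w' (fst a) + snd a = c'}
    = card {u. ?L (w - w') u = c - c'}"
    by (simp add: card_image inj_on_def)
  then show ?thesis
    using card_linear_form_fibre[of "w - w'" "c - c'"] assms by simp
qed

lemma card_fun_all: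
  fixes Q :: "'k::finite \<Rightarrow> 'c \<Rightarrow> bool"
  shows "card {a. \<forall>i. Q i (a i)} = (\<Prod>i\<in>UNIV. card {x. Q i x})"
proof -
  have "{a. \<forall>i. Q i (a i)} = (\<Pi>\<^sub>E i\<in>UNIV. {x. Q i x})"
    by (auto simp: PiE_UNIV_domain)
  then show ?thesis
    by (simp add: card_PiE)
qed

definition vec_power :: "'a::monoid_mult ^ 'd::finite \<Rightarrow> nat ^ 'd \<Rightarrow> 'a ^ 'd" where
  "vec_power x b = (\<chi> j. (x $ j) ^ (b $ j))"

text \<open>With the point fixed and \<open>a\<close> unknown, incidence splits into one affine
  condition on each \<open>a i\<close> separately, so counts of families become products over
  \<open>i\<close>.\<close>

lemma mem_variety_iff:
  "(x, y) \<in> variety h b a \<longleftrightarrow>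
    (\<forall>i. (\<Sum>j\<in>UNIV. fst (a i) $ j * vec_power x (b i) $ j) + snd (a i) = y $ i - mpoly_eval (h i) x)"
  by (auto simp: variety_def fpoly_def vec_power_def algebra_simps)

lemma card_variety_through_point:
  fixes h :: "'k::finite \<Rightarrow> ('a::{field,finite}, 'd::finite) mpoly"
  shows "card {a. p \<in> variety h b a} = CARD('a) ^ (CARD('d) * CARD('k))"
proof (cases p)
  case (Pair x y)
  show ?thesis
    unfolding Pair mem_variety_iff card_fun_all[of "\<lambda>i a. (\<Sum>j\<in>UNIV. fst a $ j * vec_power x (b i) $ j)
      + snd a = y $ i - mpoly_eval (h i) x"] card_affine_condition
    by (simp add: power_mult)
qed

lemma card_variety_through_two_points:
  fixes h :: "'k::finite \<Rightarrow> ('a::{field,finite}, 'd::finite) mpoly"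
  assumes "\<And>i j. b i $ j > 0" "\<And>i j. gcd (b i $ j) (CARD('a) - 1) = 1" "p \<noteq> p'"
  shows "CARD('a) ^ CARD('k) * card {a. p \<in> variety h b a \<and> p' \<in> variety h b a}
    \<le> CARD('a) ^ (CARD('d) * CARD('k))"
proof -
  obtain x y x' y' where p: "p = (x, y)" "p' = (x', y')"
    by fastforce
  show ?thesis
  proof (cases "x = x'")
    case True
    \<comment> \<open>A variety is the graph of a function of \<open>x\<close>, so it contains at
      most one of the two points.\<close>
    then obtain i where "y $ i \<noteq> y' $ i"
      using \<open>p \<noteq> p'\<close> by (auto simp: p vec_eq_iff)
    then have "{a. p \<in> variety h b a \<and> p' \<in> variety h b a} = {}"
      using True by (auto simp: p variety_def intro!: exI[of _ i])
    then show ?thesis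
      by (simp only: card.empty)
  next
    case False
    \<comment> \<open>Some coordinate of \<open>x\<close> and \<open>x'\<close> differs, and
      injectivity of the power map preserves this for every \<open>i\<close>.\<close>
    have ne: "vec_power x (b i) \<noteq> vec_power x' (b i)" for i
      using False inj_power_coprime_card[where 'a = 'a, OF assms(1,2)]
      unfolding vec_power_def vec_eq_iff inj_def by (simp, metis)
    let ?E = "\<lambda>i a x y. (\<Sum>j\<in>UNIV. fst a $ j * vec_power x (b i) $ j) + snd a
      = y $ i - mpoly_eval (h i) x"
    have "{a. p \<in> variety h b a \<and> p' \<in> variety h b a} = {a. \<forall>i. ?E i (a i) x y \<and> ?E i (a i) x' y'}"
      unfolding p mem_variety_iff by auto
    then have "CARD('a) ^ CARD('k) * card {a. p \<in> variety h b a \<and> p' \<in> variety h b a}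
      = (\<Prod>i\<in>UNIV. CARD('a) * card {a. ?E i a x y \<and> ?E i a x' y'})"
      by (simp add: card_fun_all[of "\<lambda>i a. ?E i a x y \<and> ?E i a x' y'"] prod.distrib)
    also have "\<dots> = CARD('a) ^ (CARD('d) * CARD('k))"
      unfolding card_two_affine_conditions[OF ne] by (simp add: power_mult)
    finally show ?thesis by simp
  qed
qed

theorem theorem1p3:
  fixes h :: "'k::finite \<Rightarrow> ('a::{field,finite}, 'd::finite) mpoly"
    and b :: "'k \<Rightarrow> nat ^ 'd"
    and P :: "(('a ^ 'd) \<times> ('a ^ 'k)) set"
    and \<V> :: "(('a ^ 'd) \<times> ('a ^ 'k)) set set"
  assumes "odd CARD('a)"
    and "\<And>i. mpoly_degree (h i) \<le> CARD('a) - 1"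
    and "\<And>i j. b i $ j > 0"
    and "\<And>i j. gcd (b i $ j) (CARD('a) - 1) = 1"
    and "\<V> \<subseteq> range (variety h b)"
  shows "\<bar>real (incidences P \<V>) - real (card P) * real (card \<V>) / real CARD('a) ^ CARD('k)\<bar>
    \<le> real CARD('a) powr (real CARD('d) * real CARD('k) / 2) * sqrt (real (card P) * real (card \<V>))"
proof -
  let ?q = "real CARD('a)" and ?dk = "CARD('d) * CARD('k)"
  have q: "?q > 0"
    by simp
  \<comment> \<open>One coefficient family is chosen per variety, so incidences can be counted over
    families without showing that \<open>variety h b\<close> is injective everywhere.\<close>
  obtain S where S: "inj_on (variety h b) S" "\<V> = variety h b ` S"
    using assms(5) by (auto simp: subset_image_inj)
  have "{(p, v) \<in> P \<times> \<V>. p \<in> v} = map_prod id (variety h b) ` {(p, a) \<in> P \<times> S. p \<in> variety h b a}"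
    unfolding S(2) by (rule set_eqI) (auto simp: image_iff Bex_def)
  moreover have "inj_on (map_prod id (variety h b)) {(p, a) \<in> P \<times> S. p \<in> variety h b a}"
    using S(1) by (auto simp: inj_on_def)
  ultimately have inc: "incidences P \<V> = card {(p, a) \<in> P \<times> S. p \<in> variety h b a}"
    by (simp add: incidences_def card_image)
  have card_S: "card \<V> = card S"
    using S by (simp add: card_image)
  have "\<bar>real (card {(p, a) \<in> P \<times> S. p \<in> variety h b a}) - real (card P) * real (card S) / ?q ^ CARD('k)\<bar>
    \<le> sqrt (?q ^ ?dk * (real (card P) * real (card S)))"
  \<comment> \<open>Here \<open>D\<close> is \<open>?q ^ ?dk\<close> and \<open>Q\<close> is
    \<open>?q ^ CARD('k)\<close>; their product counts all coefficient families.\<close>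
  proof (rule incidence_bound_of_pairwise_codegree)
    show "real (card {a. p \<in> variety h b a}) = ?q ^ ?dk" for p
      by (simp add: card_variety_through_point)
    show "real (card {a. p \<in> variety h b a \<and> p' \<in> variety h b a}) \<le> ?q ^ ?dk / ?q ^ CARD('k)"
      if "p \<noteq> p'" for p p'
    proof -
      have "real (CARD('a) ^ CARD('k) * card {a. p \<in> variety h b a \<and> p' \<in> variety h b a})
        \<le> real (CARD('a) ^ ?dk)"
        using card_variety_through_two_points[OF assms(3,4) that] by (rule of_nat_mono)
      then show ?thesis
        using q by (simp add: field_simps)
    qed
    have "CARD('k \<Rightarrow> ('a ^ 'd) \<times> 'a) = (CARD('a) ^ CARD('d) * CARD('a)) ^ CARD('k)"
      by (simp add: card_fun)
    then show "real CARD('k \<Rightarrow> ('a ^ 'd) \<times> 'a) = ?q ^ CARD('k) * ?q ^ ?dk"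
      by (simp add: power_mult_distrib power_mult)
  qed (use q in auto)
  also have "sqrt (?q ^ ?dk * (real (card P) * real (card S)))
    = ?q powr (real CARD('d) * real CARD('k) / 2) * sqrt (real (card P) * real (card S))"
  proof -
    have "sqrt (?q ^ ?dk) = (?q powr real ?dk) powr (1 / 2)"
      using q by (simp only: powr_realpow) (simp add: powr_half_sqrt)
    then show ?thesis
      using q by (simp add: real_sqrt_mult powr_powr)
  qed
  finally show ?thesis
    by (simp add: inc card_S)
qed

end
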